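(* Let $U\subseteq\mathbb R^2$ be a nonempty connected open set with coordinates $(x,u)$, let $\phi\in\mathcal C^\infty(U)$, and consider the first-order ODE $u'(x)=\phi(x,u)$, with associated vector field $A=\partial_x+\phi\,\partial_u$ and associated surface $\mathcal S=(U,g)$ of Gaussian curvature $\mathcal K$. Let $J$ be a non-trivial Jacobi field relative to $A$, and write $J=\sigma A+\delta\,\partial_u$ with $\sigma,\delta\in\mathcal C^\infty(U)$. For $h\in\mathcal C^\infty(U)$ put $\mathfrak S(h)=A(h)-\phi_u h$. Then the following hold. (1) The function $F:=A(\sigma)$ satisfies $A(F)=0$. If $F$ is not constant on $U$, then there is a nonempty open subset of $U$ on which $F$ is a first integral of the Pfaffian equation $-\phi\,dx+du\equiv 0$. (2) If $A(\sigma)=a$ for a constant $a\in\mathbb R$, then the function $G:=\sigma-ax$ satisfies $A(G)=0$. If $G$ is not constant on $U$, then there is a nonempty open subset of $U$ on which $G$ is a first integral of $-\phi\,dx+du\equiv 0$. (3) If $A(\sigma)=a$ and $\sigma-ax=b$ for constants $a,b\in\mathbb R$, then $\delta$ is not identically zero on $U$. (4) Suppose that $\delta$ is not identically zero on $U$. (a) If $\mathfrak S(\delta)=0$ on $U$, then every point at which $\delta\neq 0$ has an open neighbourhood on which $\delta^{-1}$ is an integrating factor for $-\phi\,dx+du\equiv0$. (b) If $\mathfrak S(\delta)$ is not identically zero on $U$, then every point at which $\mathfrak S(\delta)\neq 0$ has an open neighbourhood on which $\mathfrak S(\delta)$ is an integrating factor for $-\phi\,dx+du\equiv 0$. In particular,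 a non-trivial Jacobi field relative to $A$ always yields, by at most a quadrature, a first integral of $-\phi\,dx+du\equiv 0$ on some nonempty open subset of $U$.
   Context: Subscripts denote partial derivatives, and vector fields act on functions as derivations. First integral and integrating factor: on an open set $V\subseteq U$, a function $F\in\mathcal C^\infty(V)$ is a first integral of $-\phi\,dx+du\equiv0$ if $dF=\mu(-\phi\,dx+du)$ on $V$ for some non-vanishing $\mu\in\mathcal C^\infty(V)$. Such a function $\mu$ is called an integrating factor on $V$; that is, a non-vanishing $\mu\in\mathcal C^\infty(V)$ is an integrating factor on $V$ if there exists $F\in \mathcal C^\infty(V)$ with $dF=\mu(-\phi\,dx+du)$. Associated surface: $\mathcal S=(U,g)$, where $g$ is the Riemannian metric whose matrix in the coordinates $(x,u)$ is $\begin{pmatrix}1+\phi^2&-\phi\\-\phi&1\end{pmatrix}$. The vector fields $A$ and $\partial_u$ form an orthonormal frame for $g$. Let $\nabla$ be the Levi-Civita connection of $g$. For $X=x_1A+x_2\partial_u$ and $Y=y_1A+y_2\partial_u$ it is given by $\nabla_XY=(X(y_1)-\phi_u x_2y_2)A+(X(y_2)+\phi_u x_2y_1)\partial_u$. The vector field $A$ is geodesic, i.e. $\nabla_AA=0$. The Gaussian curvature of $\mathcal S$ is $\mathcal K=-\partial_u(A(\phi))$. Jacobi field relative to $A$: a smooth vector field $J$ on $U$ such that $\nabla_A\nabla_AJ+\mathcal K\,(g(A,A)J-g(J,A)A)=0$, where $g(A,A)=1$. The fields $J=(ax+b)A$ with $a,b\in\mathbb R$ are Jacobi fields relative to $A$,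 called trivial; every other Jacobi field relative to $A$ is called non-trivial. *)

theory Defs
  imports "HOL-Analysis.Analysis"
begin

(* For open S, C_k_on k S f says that all k-fold iterated directional derivatives
   of f exist and are continuous on S. *)
primrec C_k_on :: "nat \<Rightarrow> 'a::real_normed_vector set \<Rightarrow> ('a \<Rightarrow> 'b::real_normed_vector) \<Rightarrow> bool" where
  "C_k_on 0 S f \<longleftrightarrow> continuous_on S f"
| "C_k_on (Suc k) S f \<longleftrightarrow>
     (\<forall>x\<in>S. f differentiable (at x)) \<and> (\<forall>v. C_k_on k S (\<lambda>x. frechet_derivative f (at x) v))"

definition smooth_on :: "'a::real_normed_vector set \<Rightarrow> ('a \<Rightarrow> 'b::real_normed_vector) \<Rightarrow> bool" where
  "smooth_on S f \<longleftrightarrow> (\<forall>k. C_k_on k S f)"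

(* Vector fields are given by their components in the standard coordinates. *)
definition derivation :: "('a::real_normed_vector \<Rightarrow> 'a) \<Rightarrow> ('a \<Rightarrow> real) \<Rightarrow> 'a \<Rightarrow> real" where
  "derivation X f p = frechet_derivative f (at p) (X p)"

definition lie_bracket :: "('a::real_normed_vector \<Rightarrow> 'a) \<Rightarrow> ('a \<Rightarrow> 'a) \<Rightarrow> 'a \<Rightarrow> 'a" where
  "lie_bracket X Y p = frechet_derivative Y (at p) (X p) - frechet_derivative X (at p) (Y p)"

(* g p v w is the metric at the point p on the tangent vectors v and w. *)
type_synonym 'a metric_field = "'a \<Rightarrow> 'a \<Rightarrow> 'a \<Rightarrow> real"

(* The Levi-Civita connection applied to the constant vector fields v and w, at p: these fields
   commute, so the bracket terms of the Koszul formula vanish.  For basis vectors v and w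
   the components of the result are the Christoffel symbols. *)
definition christoffel :: "'a::euclidean_space metric_field \<Rightarrow> 'a \<Rightarrow> 'a \<Rightarrow> 'a \<Rightarrow> 'a" where
  "christoffel g p v w = (THE c. \<forall>z. 2 * g p c z =
      derivation (\<lambda>_. v) (\<lambda>q. g q w z) p
    + derivation (\<lambda>_. w) (\<lambda>q. g q v z) p
    - derivation (\<lambda>_. z) (\<lambda>q. g q v w) p)"

definition levi_civita ::
    "'a::euclidean_space metric_field \<Rightarrow> ('a \<Rightarrow> 'a) \<Rightarrow> ('a \<Rightarrow> 'a) \<Rightarrow> 'a \<Rightarrow> 'a" where
  "levi_civita g X Y p = frechet_derivative Y (at p) (X p) + christoffel g p (X p) (Y p)"

definition riemann_curvature ::
    "'a::euclidean_space metric_field \<Rightarrow> ('a \<Rightarrow> 'a) \<Rightarrow> ('a \<Rightarrow> 'a) \<Rightarrow> ('a \<Rightarrow> 'a) \<Rightarrow> 'a \<Rightarrow> 'a" where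
  "riemann_curvature g X Y Z p =
     levi_civita g X (levi_civita g Y Z) p - levi_civita g Y (levi_civita g X Z) p
     - levi_civita g (lie_bracket X Y) Z p"

definition gauss_curvature :: "(real \<times> real) metric_field \<Rightarrow> real \<times> real \<Rightarrow> real" where
  "gauss_curvature g p =
     g p (riemann_curvature g (\<lambda>_. (1, 0)) (\<lambda>_. (0, 1)) (\<lambda>_. (0, 1)) p) (1, 0)
     / (g p (1, 0) (1, 0) * g p (0, 1) (0, 1) - (g p (1, 0) (0, 1))\<^sup>2)"

definition partial_u :: "real \<times> real \<Rightarrow> real \<times> real" where
  "partial_u p = (0, 1)"

definition ode_field :: "(real \<times> real \<Rightarrow> real) \<Rightarrow> real \<times> real \<Rightarrow> real \<times> real" where
  "ode_field \<phi> p = (1, \<phi> p)"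

definition ode_metric :: "(real \<times> real \<Rightarrow> real) \<Rightarrow> (real \<times> real) metric_field" where
  "ode_metric \<phi> p v w =
     (1 + (\<phi> p)\<^sup>2) * fst v * fst w - \<phi> p * (fst v * snd w + snd v * fst w) + snd v * snd w"

definition jacobi_field ::
    "(real \<times> real) set \<Rightarrow> (real \<times> real \<Rightarrow> real) \<Rightarrow> (real \<times> real \<Rightarrow> real \<times> real) \<Rightarrow> bool" where
  "jacobi_field U \<phi> J \<longleftrightarrow> smooth_on U J \<and>
     (let g = ode_metric \<phi>; A = ode_field \<phi> in
      \<forall>p\<in>U. levi_civita g A (levi_civita g A J) p
        + gauss_curvature g p *\<^sub>R (g p (A p) (A p) *\<^sub>R J p - g p (J p) (A p) *\<^sub>R A p) = 0)"

definition trivial_jacobi_field ::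
    "(real \<times> real) set \<Rightarrow> (real \<times> real \<Rightarrow> real) \<Rightarrow> (real \<times> real \<Rightarrow> real \<times> real) \<Rightarrow> bool" where
  "trivial_jacobi_field U \<phi> J \<longleftrightarrow> (\<exists>a b. \<forall>p\<in>U. J p = (a * fst p + b) *\<^sub>R ode_field \<phi> p)"

definition nontrivial_jacobi_field ::
    "(real \<times> real) set \<Rightarrow> (real \<times> real \<Rightarrow> real) \<Rightarrow> (real \<times> real \<Rightarrow> real \<times> real) \<Rightarrow> bool" where
  "nontrivial_jacobi_field U \<phi> J \<longleftrightarrow> jacobi_field U \<phi> J \<and> \<not> trivial_jacobi_field U \<phi> J"

(* dF = mu (-phi dx + du) on V *)
definition pfaff_differential ::
    "(real \<times> real) set \<Rightarrow> (real \<times> real \<Rightarrow> real) \<Rightarrow> (real \<times> real \<Rightarrow> real) \<Rightarrow> (real \<times> real \<Rightarrow> real) \<Rightarrow> bool" where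
  "pfaff_differential V \<phi> \<mu> F \<longleftrightarrow>
     (\<forall>p\<in>V. (F has_derivative (\<lambda>v. \<mu> p * (- \<phi> p * fst v + snd v))) (at p))"

definition nonvanishing_smooth_on :: "(real \<times> real) set \<Rightarrow> (real \<times> real \<Rightarrow> real) \<Rightarrow> bool" where
  "nonvanishing_smooth_on V \<mu> \<longleftrightarrow> smooth_on V \<mu> \<and> (\<forall>p\<in>V. \<mu> p \<noteq> 0)"

(* V is meant to be an open subset of the domain of phi in the following three definitions. *)
definition first_integral_on ::
    "(real \<times> real) set \<Rightarrow> (real \<times> real \<Rightarrow> real) \<Rightarrow> (real \<times> real \<Rightarrow> real) \<Rightarrow> bool" where
  "first_integral_on V \<phi> F \<longleftrightarrow> smooth_on V F \<and>
     (\<exists>\<mu>. nonvanishing_smooth_on V \<mu> \<and> pfaff_differential V \<phi> \<mu> F)"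

definition integrating_factor_on ::
    "(real \<times> real) set \<Rightarrow> (real \<times> real \<Rightarrow> real) \<Rightarrow> (real \<times> real \<Rightarrow> real) \<Rightarrow> bool" where
  "integrating_factor_on V \<phi> \<mu> \<longleftrightarrow> nonvanishing_smooth_on V \<mu> \<and>
     (\<exists>F. smooth_on V F \<and> pfaff_differential V \<phi> \<mu> F)"

(* F is computed on V by a single quadrature: F p is the line integral of
   mu (-phi dx + du) along the segment from a base point p0 to p. *)
definition pfaff_quadrature_on ::
    "(real \<times> real) set \<Rightarrow> (real \<times> real \<Rightarrow> real) \<Rightarrow> (real \<times> real \<Rightarrow> real) \<Rightarrow> (real \<times> real \<Rightarrow> real) \<Rightarrow> bool" where
  "pfaff_quadrature_on V \<phi> \<mu> F \<longleftrightarrow>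
     (\<exists>p0\<in>V. \<forall>p\<in>V. closed_segment p0 p \<subseteq> V \<and>
       ((\<lambda>t. let q = p0 + t *\<^sub>R (p - p0) in
              \<mu> q * (- \<phi> q * (fst p - fst p0) + (snd p - snd p0))) has_integral F p) {0..1})"

definition frak_S :: "(real \<times> real \<Rightarrow> real) \<Rightarrow> (real \<times> real \<Rightarrow> real) \<Rightarrow> real \<times> real \<Rightarrow> real" where
  "frak_S \<phi> h p = derivation (ode_field \<phi>) h p - derivation partial_u \<phi> p * h p"

end

theory Submission
  imports Defs
begin

text \<open>
  The frame \<open>A\<close>, \<open>\<partial>\<^sub>u\<close> is orthonormal and \<open>A\<close> is geodesic, so the Jacobi equation
  for \<open>J = \<sigma> A + \<delta> \<partial>\<^sub>u\<close> splits into \<open>A (A \<sigma>) = 0\<close> and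
  \<open>A (A \<delta>) = (A \<phi>\<^sub>u + \<phi>\<^sub>u\<^sup>2) \<delta>\<close>. A non-constant function annihilated by \<open>A\<close>
  has differential \<open>F\<^sub>u (- \<phi> dx + du)\<close>, and the second equation factors as
  \<open>A \<mu> = - \<phi>\<^sub>u \<mu>\<close> for \<open>\<mu> = A \<delta> - \<phi>\<^sub>u \<delta>\<close>, with \<open>1 / \<delta>\<close> solving the same
  equation when this \<open>\<mu>\<close> vanishes. That equation says that \<open>\<mu> (- \<phi> dx + du)\<close> is closed, so
  integration along the segments of a ball gives a primitive.
\<close>

section \<open>Smooth functions\<close>

text \<open>Two functions that agree near \<open>x\<close> have the same set of derivatives at
  \<open>x\<close>. The choice operator behind \<open>frechet_derivative\<close> then selects the
  same value for both, whether or not a derivative exists.\<close>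

lemma frechet_derivative_cong_open:
  assumes "open S" "x \<in> S" "\<And>y. y \<in> S \<Longrightarrow> f y = g y"
  shows "frechet_derivative f (at x) = frechet_derivative g (at x)"
proof -
  have "(f has_derivative f') (at x) \<longleftrightarrow> (g has_derivative f') (at x)" for f'
    using has_derivative_transform_within_open[of f f' x UNIV S g]
      has_derivative_transform_within_open[of g f' x UNIV S f] assms by auto
  then show ?thesis
    by (simp add: frechet_derivative_def)
qed

lemma differentiable_cong_open:
  assumes "open S" "x \<in> S" "\<And>y. y \<in> S \<Longrightarrow> f y = g y" "f differentiable (at x)"
  shows "g differentiable (at x)"
  using assms has_derivative_transform_within_open[of f _ x UNIV S g]
  unfolding differentiable_def by auto

lemma C_k_on_cong:
  assumes "open S" "\<And>x. x \<in> S \<Longrightarrow> f x = g x" "C_k_on k S f"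
  shows "C_k_on k S g"
  using assms(2,3)
proof (induction k arbitrary: f g)
  case 0
  then show ?case by (simp cong: continuous_on_cong)
next
  case (Suc k)
  show ?case
    unfolding C_k_on.simps
  proof (intro conjI ballI allI)
    fix x assume "x \<in> S"
    then show "g differentiable at x"
      using Suc.prems by (auto intro: differentiable_cong_open[OF assms(1), of x f g])
  next
    fix v
    have "frechet_derivative f (at x) v = frechet_derivative g (at x) v" if "x \<in> S" for x
      using frechet_derivative_cong_open[OF assms(1) that, of f g] Suc.prems(1) by auto
    then show "C_k_on k S (\<lambda>x. frechet_derivative g (at x) v)"
      using Suc.IH[of "\<lambda>x. frechet_derivative f (at x) v" "\<lambda>x. frechet_derivative g (at x) v"]
        Suc.prems(2) by simp
  qed
qed

lemma C_k_on_continuous: "C_k_on k S f \<Longrightarrow> continuous_on S f"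
  by (cases k)
    (auto intro!: continuous_at_imp_continuous_on differentiable_imp_continuous_within)

text \<open>The recursion records continuity only at the last order. Lower orders are recovered by
  induction through the directional derivatives, starting from the fact that a differentiable
  function is continuous.\<close>

lemma C_k_on_SucD: "C_k_on (Suc k) S f \<Longrightarrow> C_k_on k S f"
proof (induction k arbitrary: f)
  case 0
  then show ?case using C_k_on_continuous[of "Suc 0"] by simp
next
  case (Suc k)
  show ?case
    unfolding C_k_on.simps(2)[of k S f]
  proof (intro conjI allI)
    show "\<forall>x\<in>S. f differentiable at x"
      using Suc.prems by simp
    fix v
    have "C_k_on (Suc k) S (\<lambda>x. frechet_derivative f (at x) v)"
      using Suc.prems unfolding C_k_on.simps(2)[of "Suc k"] by blast
    then show "C_k_on k S (\<lambda>x. frechet_derivative f (at x) v)"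
      by (rule Suc.IH)
  qed
qed

text \<open>By uniqueness of the derivative, any explicit formula \<open>f'\<close> may stand in for
  \<open>frechet_derivative\<close>. The closure properties can therefore be proved from the usual
  rules of differentiation.\<close>

lemma C_k_on_SucI:
  assumes "open S"
    and "\<And>x. x \<in> S \<Longrightarrow> (f has_derivative f' x) (at x)"
    and "\<And>v. C_k_on k S (\<lambda>x. f' x v)"
  shows "C_k_on (Suc k) S f"
proof -
  have "f' x v = frechet_derivative f (at x) v" if "x \<in> S" for x v
    using frechet_derivative_at[OF assms(2)[OF that]] by simp
  then have "C_k_on k S (\<lambda>x. frechet_derivative f (at x) v)" for v
    by (intro C_k_on_cong[OF assms(1) _ assms(3)[of v]])
  moreover have "\<forall>x\<in>S. f differentiable at x"
    using assms(2) differentiable_def by blast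
  ultimately show ?thesis by simp
qed

lemma C_k_on_has_derivative:
  "C_k_on (Suc k) S f \<Longrightarrow> x \<in> S \<Longrightarrow> (f has_derivative frechet_derivative f (at x)) (at x)"
  by (simp add: frechet_derivative_works[symmetric])

lemma C_k_on_frechet_derivative:
  "C_k_on (Suc k) S f \<Longrightarrow> C_k_on k S (\<lambda>x. frechet_derivative f (at x) v)"
  by simp

section \<open>Closure of C^k under algebraic operations\<close>

lemma C_k_on_const: "open S \<Longrightarrow> C_k_on k S (\<lambda>x. c)"
  by (induction k arbitrary: c) (auto intro!: continuous_intros)

lemma C_k_on_add:
  assumes "open S"
  shows "C_k_on k S f \<Longrightarrow> C_k_on k S g \<Longrightarrow> C_k_on k S (\<lambda>x. f x + g x)"
proof (induction k arbitrary: f g)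
  case 0
  then show ?case by (auto intro: continuous_intros)
next
  case (Suc k)
  show ?case
  proof (rule C_k_on_SucI[OF assms])
    fix x assume "x \<in> S"
    then show "((\<lambda>x. f x + g x) has_derivative
        (\<lambda>v. frechet_derivative f (at x) v + frechet_derivative g (at x) v)) (at x)"
      by (intro has_derivative_add Suc.prems[THEN C_k_on_has_derivative])
  next
    fix v
    show "C_k_on k S (\<lambda>x. frechet_derivative f (at x) v + frechet_derivative g (at x) v)"
      by (intro Suc.IH C_k_on_frechet_derivative Suc.prems)
  qed
qed

text \<open>Leibniz' rule expresses the derivative through products of lower order. The
  undifferentiated factors drop one order by \<open>C_k_on_SucD\<close>.\<close>

lemma C_k_on_mult:
  fixes f g :: "'a::real_normed_vector \<Rightarrow> real"
  assumes "open S"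
  shows "C_k_on k S f \<Longrightarrow> C_k_on k S g \<Longrightarrow> C_k_on k S (\<lambda>x. f x * g x)"
proof (induction k arbitrary: f g)
  case 0
  then show ?case by (auto intro: continuous_intros)
next
  case (Suc k)
  show ?case
  proof (rule C_k_on_SucI[OF assms])
    fix x assume "x \<in> S"
    then show "((\<lambda>x. f x * g x) has_derivative
        (\<lambda>v. f x * frechet_derivative g (at x) v + frechet_derivative f (at x) v * g x)) (at x)"
      by (intro has_derivative_mult Suc.prems[THEN C_k_on_has_derivative])
  next
    fix v
    show "C_k_on k S (\<lambda>x. f x * frechet_derivative g (at x) v + frechet_derivative f (at x) v * g x)"
      by (intro C_k_on_add[OF assms] Suc.IH C_k_on_frechet_derivative Suc.prems
          Suc.prems[THEN C_k_on_SucD])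
  qed
qed

lemma C_k_on_inverse:
  fixes f :: "'a::real_normed_vector \<Rightarrow> real"
  assumes "open S" "\<And>x. x \<in> S \<Longrightarrow> f x \<noteq> 0"
  shows "C_k_on k S f \<Longrightarrow> C_k_on k S (\<lambda>x. inverse (f x))"
proof (induction k)
  case 0
  then show ?case using assms(2) by (auto intro!: continuous_intros)
next
  case (Suc k)
  have IH: "C_k_on k S (\<lambda>x. inverse (f x))"
    by (rule Suc.IH[OF C_k_on_SucD[OF Suc.prems]])
  show ?case
  proof (rule C_k_on_SucI[OF assms(1)])
    fix x assume x: "x \<in> S"
    have "((\<lambda>x. inverse (f x)) has_derivative
        (\<lambda>v. - (inverse (f x) * frechet_derivative f (at x) v * inverse (f x)))) (at x)"
      by (rule Deriv.has_derivative_inverse[OF assms(2)[OF x] C_k_on_has_derivative[OF Suc.prems x]])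
    \<comment> \<open>The sign becomes a factor \<open>- 1\<close>, so that the derivative is a
      product of the constant, \<open>1 / f\<close> twice and a derivative of \<open>f\<close>, each
      of them C^k by now.\<close>
    then show "((\<lambda>x. inverse (f x)) has_derivative
        (\<lambda>v. - 1 * (inverse (f x) * frechet_derivative f (at x) v * inverse (f x)))) (at x)"
      by simp
  next
    fix v
    show "C_k_on k S (\<lambda>x. - 1 * (inverse (f x) * frechet_derivative f (at x) v * inverse (f x)))"
      by (intro C_k_on_mult[OF assms(1)] C_k_on_const[OF assms(1)] IH
          C_k_on_frechet_derivative[OF Suc.prems])
  qed
qed

section \<open>Smooth functions\<close>

lemma smooth_on_cong:
  "open S \<Longrightarrow> (\<And>x. x \<in> S \<Longrightarrow> f x = g x) \<Longrightarrow> smooth_on S f \<Longrightarrow> smooth_on S g"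
  unfolding smooth_on_def using C_k_on_cong by blast

lemma smooth_on_subset:
  assumes "smooth_on S f" "T \<subseteq> S"
  shows "smooth_on T f"
proof -
  have "C_k_on k S f \<Longrightarrow> C_k_on k T f" for k
    using assms(2) by (induction k arbitrary: f) (auto intro: continuous_on_subset)
  then show ?thesis
    using assms(1) unfolding smooth_on_def by blast
qed

lemma smooth_on_const: "open S \<Longrightarrow> smooth_on S (\<lambda>x. c)"
  unfolding smooth_on_def using C_k_on_const by blast

lemma smooth_on_add: "open S \<Longrightarrow> smooth_on S f \<Longrightarrow> smooth_on S g \<Longrightarrow> smooth_on S (\<lambda>x. f x + g x)"
  unfolding smooth_on_def using C_k_on_add by blast

lemma smooth_on_mult:
  fixes f g :: "'a::real_normed_vector \<Rightarrow> real"
  shows "open S \<Longrightarrow> smooth_on S f \<Longrightarrow> smooth_on S g \<Longrightarrow> smooth_on S (\<lambda>x. f x * g x)"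
  unfolding smooth_on_def using C_k_on_mult by blast

lemma smooth_on_diff:
  fixes f g :: "'a::real_normed_vector \<Rightarrow> real"
  assumes "open S" "smooth_on S f" "smooth_on S g"
  shows "smooth_on S (\<lambda>x. f x - g x)"
  using smooth_on_add[OF assms(1,2) smooth_on_mult[OF assms(1) smooth_on_const[OF assms(1), of "-1"] assms(3)]]
  by simp

lemma smooth_on_uminus:
  fixes f :: "'a::real_normed_vector \<Rightarrow> real"
  shows "open S \<Longrightarrow> smooth_on S f \<Longrightarrow> smooth_on S (\<lambda>x. - f x)"
  using smooth_on_mult[of S "\<lambda>_. -1" f] smooth_on_const[of S "-1 :: real"] by simp

lemma smooth_on_inverse:
  fixes f :: "'a::real_normed_vector \<Rightarrow> real"
  shows "open S \<Longrightarrow> (\<And>x. x \<in> S \<Longrightarrow> f x \<noteq> 0) \<Longrightarrow> smooth_on S f \<Longrightarrow> smooth_on S (\<lambda>x. inverse (f x))"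
  unfolding smooth_on_def using C_k_on_inverse by blast

lemma smooth_on_frechet_derivative:
  "smooth_on S f \<Longrightarrow> smooth_on S (\<lambda>x. frechet_derivative f (at x) v)"
  unfolding smooth_on_def using C_k_on_frechet_derivative by blast

lemma smooth_on_has_derivative:
  "smooth_on S f \<Longrightarrow> x \<in> S \<Longrightarrow> (f has_derivative frechet_derivative f (at x)) (at x)"
  unfolding smooth_on_def by (meson C_k_on_has_derivative)

lemma smooth_on_differentiable: "smooth_on S f \<Longrightarrow> x \<in> S \<Longrightarrow> f differentiable (at x)"
  using smooth_on_has_derivative differentiable_def by blast

lemma smooth_on_imp_continuous_on: "smooth_on S f \<Longrightarrow> continuous_on S f"
  unfolding smooth_on_def using C_k_on_continuous by blast

lemma open_nonzero_set:
  assumes "open S" "smooth_on S f"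
  shows "open {x \<in> S. f x \<noteq> 0}"
proof -
  have "{x \<in> S. f x \<noteq> 0} = S \<inter> f -` (- {0})"
    by auto
  then show ?thesis
    using continuous_open_preimage[OF smooth_on_imp_continuous_on[OF assms(2)] assms(1)
        open_Compl[OF closed_singleton[of 0]]] by simp
qed

lemma smooth_onI:
  assumes "open S"
    and "\<And>x. x \<in> S \<Longrightarrow> (f has_derivative f' x) (at x)"
    and "\<And>v. smooth_on S (\<lambda>x. f' x v)"
  shows "smooth_on S f"
proof -
  have "C_k_on (Suc k) S f" for k
    using C_k_on_SucI[OF assms(1,2)] assms(3) unfolding smooth_on_def by blast
  then show ?thesis
    unfolding smooth_on_def using C_k_on_SucD by blast
qed

lemma smooth_on_fst: "open S \<Longrightarrow> smooth_on S (\<lambda>x :: real \<times> real. fst x)"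
  by (rule smooth_onI[where f' = "\<lambda>_ v. fst v"])
    (auto intro!: derivative_eq_intros smooth_on_const)

section \<open>Partial derivatives in the plane\<close>

definition dx :: "(real \<times> real \<Rightarrow> real) \<Rightarrow> real \<times> real \<Rightarrow> real" where
  "dx f p = frechet_derivative f (at p) (1, 0)"

definition du :: "(real \<times> real \<Rightarrow> real) \<Rightarrow> real \<times> real \<Rightarrow> real" where
  "du f p = frechet_derivative f (at p) (0, 1)"

lemma frechet_derivative_pair:
  assumes "f differentiable (at p)"
  shows "frechet_derivative f (at p) v = fst v * dx f p + snd v * du f p"
proof -
  have lin: "linear (frechet_derivative f (at p))"
    using assms by (rule linear_frechet_derivative)
  have "frechet_derivative f (at p) (fst v *\<^sub>R (1, 0) + snd v *\<^sub>R (0, 1))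
      = fst v * dx f p + snd v * du f p"
    by (simp only: linear_add[OF lin] linear_scale[OF lin] dx_def du_def real_scaleR_def)
  then show ?thesis
    by simp
qed

text \<open>This explicit form of the differential lets the derivative rules compute with
  \<open>dx\<close> and \<open>du\<close>; \<open>partials_eq\<close> reads the coefficients back
  off.\<close>

lemma has_derivative_partials:
  "smooth_on S f \<Longrightarrow> p \<in> S \<Longrightarrow>
    (f has_derivative (\<lambda>v. fst v * dx f p + snd v * du f p)) (at p)"
  using smooth_on_has_derivative[of S f p] frechet_derivative_pair[of f p]
  by (simp add: differentiable_def) (metis (no_types, lifting) ext)

lemma partials_eq:
  assumes "(f has_derivative (\<lambda>v. fst v * a + snd v * b)) (at p)"
  shows "dx f p = a" "du f p = b"
  using frechet_derivative_at[OF assms, symmetric] by (simp_all add: dx_def du_def)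

lemma smooth_on_partials:
  "smooth_on S f \<Longrightarrow> smooth_on S (dx f)" "smooth_on S f \<Longrightarrow> smooth_on S (du f)"
  using smooth_on_frechet_derivative[of S f] by (simp_all add: dx_def[abs_def] du_def[abs_def])

section \<open>Calculus of derivations along a vector field\<close>

lemma derivation_eq:
  "f differentiable (at p) \<Longrightarrow> derivation X f p = fst (X p) * dx f p + snd (X p) * du f p"
  by (simp add: derivation_def frechet_derivative_pair)

lemma derivation_ode_field:
  "smooth_on S f \<Longrightarrow> p \<in> S \<Longrightarrow> derivation (ode_field \<phi>) f p = dx f p + \<phi> p * du f p"
  by (simp add: derivation_eq smooth_on_differentiable ode_field_def)

lemma derivation_eq_has_derivative:
  "(f has_derivative f') (at p) \<Longrightarrow> derivation X f p = f' (X p)"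
  by (simp add: derivation_def frechet_derivative_at[symmetric])

lemma derivation_const [simp]: "derivation X (\<lambda>_. c) p = 0"
  by (simp add: derivation_def)

lemma derivation_cong_open:
  "open S \<Longrightarrow> p \<in> S \<Longrightarrow> (\<And>q. q \<in> S \<Longrightarrow> f q = g q) \<Longrightarrow> derivation X f p = derivation X g p"
  using frechet_derivative_cong_open[of S p f g] by (simp add: derivation_def)

lemma derivation_diff:
  "smooth_on S f \<Longrightarrow> smooth_on S g \<Longrightarrow> p \<in> S \<Longrightarrow>
    derivation X (\<lambda>q. f q - g q) p = derivation X f p - derivation X g p"
  by (subst derivation_eq_has_derivative[OF has_derivative_diff[OF
          smooth_on_has_derivative smooth_on_has_derivative]])
    (simp_all add: derivation_def)

lemma derivation_mult:
  "smooth_on S f \<Longrightarrow> smooth_on S g \<Longrightarrow> p \<in> S \<Longrightarrow>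
    derivation X (\<lambda>q. f q * g q) p = f p * derivation X g p + derivation X f p * g p"
  by (subst derivation_eq_has_derivative[OF has_derivative_mult[OF
          smooth_on_has_derivative smooth_on_has_derivative]])
    (simp_all add: derivation_def)

lemma derivation_inverse:
  "smooth_on S f \<Longrightarrow> p \<in> S \<Longrightarrow> f p \<noteq> 0 \<Longrightarrow>
    derivation X (\<lambda>q. inverse (f q)) p = - (derivation X f p / (f p)\<^sup>2)"
  by (subst derivation_eq_has_derivative[OF Deriv.has_derivative_inverse[OF _
          smooth_on_has_derivative]])
    (simp_all add: derivation_def power2_eq_square divide_inverse)

section \<open>The connection and the curvature\<close>

context
  fixes U :: "(real \<times> real) set" and \<phi> :: "real \<times> real \<Rightarrow> real"
  assumes open_U: "open U" and smooth_phi: "smooth_on U \<phi>"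
begin

abbreviation (input) "A \<equiv> derivation (ode_field \<phi>)"

text \<open>This is the Pfaffian form - \<phi> dx + du evaluated on \<open>v\<close>. It vanishes on
  A and takes the value 1 on the field \<open>partial_u\<close>, so dx and \<theta> are the coframe
  dual to A and \<open>partial_u\<close>.\<close>

abbreviation (input) "\<theta> p v \<equiv> snd v - \<phi> p * fst v"

lemma smooth_on_derivation:
  assumes "smooth_on U f" shows "smooth_on U (A f)"
proof (rule smooth_on_cong[OF open_U, of "\<lambda>p. dx f p + \<phi> p * du f p"])
  show "smooth_on U (\<lambda>p. dx f p + \<phi> p * du f p)"
    by (intro smooth_on_add smooth_on_mult smooth_on_partials open_U smooth_phi assms)
qed (simp add: derivation_ode_field[of U] assms)

text \<open>As a sum of squares of the dual coframe, dx^2 + \<theta>^2, the metric visibly has A and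
  \<open>partial_u\<close> as an orthonormal frame.\<close>

lemma ode_metric_eq: "ode_metric \<phi> p v w = fst v * fst w + \<theta> p v * \<theta> p w"
  by (simp add: ode_metric_def algebra_simps power2_eq_square)

text \<open>Only \<theta> depends on the point: along \<open>v\<close>, the value \<theta>(w)
  changes at the rate - (v \<phi>) \<open>fst w\<close>. The product rule gives the rest.\<close>

lemma derivation_ode_metric:
  assumes "p \<in> U"
  shows "derivation (\<lambda>_. v) (\<lambda>q. ode_metric \<phi> q w z) p =
    - (fst v * dx \<phi> p + snd v * du \<phi> p) * (fst w * \<theta> p z + fst z * \<theta> p w)"
proof -
  have "((\<lambda>q. ode_metric \<phi> q w z) has_derivative
      (\<lambda>v. - (fst v * dx \<phi> p + snd v * du \<phi> p) * (fst w * \<theta> p z + fst z * \<theta> p w))) (at p)"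
    unfolding ode_metric_eq
    by (rule derivative_eq_intros has_derivative_partials[OF smooth_phi assms] refl | simp add: algebra_simps)+
  then show ?thesis
    unfolding derivation_def by (simp add: frechet_derivative_at[symmetric])
qed

text \<open>Splitting v \<phi> = \<open>fst v\<close> A(\<phi>) + \<theta>(v) \<phi>_u in the Koszul
  formula makes the mixed terms cancel. Taking z = A leaves - 2 \<phi>_u \<theta>(v) \<theta>(w),
  and taking z = \<open>partial_u\<close> leaves - 2 \<open>fst v * fst w\<close> A(\<phi>).\<close>

lemma christoffel_ode_metric:
  assumes "p \<in> U"
  shows "christoffel (ode_metric \<phi>) p v w =
    (- du \<phi> p * \<theta> p v * \<theta> p w) *\<^sub>R ode_field \<phi> p - (fst v * fst w * A \<phi> p) *\<^sub>R (0, 1)"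
    (is "_ = ?c")
  unfolding christoffel_def derivation_ode_metric[OF assms]
proof (rule the_equality)
  let ?R = "\<lambda>z. - (fst v * dx \<phi> p + snd v * du \<phi> p) * (fst w * \<theta> p z + fst z * \<theta> p w)
    + - (fst w * dx \<phi> p + snd w * du \<phi> p) * (fst v * \<theta> p z + fst z * \<theta> p v)
    - - (fst z * dx \<phi> p + snd z * du \<phi> p) * (fst v * \<theta> p w + fst w * \<theta> p v)"
  show c: "\<forall>z. 2 * ode_metric \<phi> p ?c z = ?R z"
    by (simp add: ode_metric_eq derivation_ode_field[OF smooth_phi assms, of \<phi>] ode_field_def algebra_simps)
  fix c assume "\<forall>z. 2 * ode_metric \<phi> p c z = ?R z"
  then have "ode_metric \<phi> p c z = ode_metric \<phi> p ?c z" for z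
    using c by (metis mult_cancel_left zero_neq_numeral)
  \<comment> \<open>The metric products with \<open>partial_u\<close> and with A are \<theta>(c) and
    \<open>fst c\<close>, and these two numbers determine \<open>c\<close>.\<close>
  from this[of "(0, 1)"] this[of "(1, \<phi> p)"] show "c = ?c"
    by (simp add: ode_metric_eq prod_eq_iff)
qed

text \<open>The coordinate derivative of A along X is (X \<phi>) \<open>partial_u\<close>, and the
  Christoffel term cancels its part containing A(\<phi>). What remains is a rotation of the frame at
  the rate \<phi>_u \<theta>(X). The shape of \<open>Y\<close> is assumed only on \<open>U\<close>,
  so the lemma can be applied again to its own result.\<close>

lemma levi_civita_ode_metric:
  assumes "p \<in> U" and "smooth_on U s" "smooth_on U d"
    and Y: "\<And>q. q \<in> U \<Longrightarrow> Y q = s q *\<^sub>R ode_field \<phi> q + d q *\<^sub>R (0, 1)"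
  shows "levi_civita (ode_metric \<phi>) X Y p =
    (derivation X s p - du \<phi> p * \<theta> p (X p) * d p) *\<^sub>R ode_field \<phi> p
    + (derivation X d p + du \<phi> p * \<theta> p (X p) * s p) *\<^sub>R (0, 1)"
proof -
  have "((\<lambda>q. (s q, s q * \<phi> q + d q)) has_derivative
     (\<lambda>v. (fst v * dx s p + snd v * du s p,
        (s p * (fst v * dx \<phi> p + snd v * du \<phi> p) + (fst v * dx s p + snd v * du s p) * \<phi> p)
        + (fst v * dx d p + snd v * du d p)))) (at p)"
    by (intro has_derivative_Pair has_derivative_add has_derivative_mult has_derivative_partials[OF _ assms(1)]
        smooth_phi assms(2,3))
  from frechet_derivative_at[OF this] frechet_derivative_cong_open[OF open_U assms(1),
      of Y "\<lambda>q. (s q, s q * \<phi> q + d q)"]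
  have "frechet_derivative Y (at p) =
     (\<lambda>v. (fst v * dx s p + snd v * du s p,
        (s p * (fst v * dx \<phi> p + snd v * du \<phi> p) + (fst v * dx s p + snd v * du s p) * \<phi> p)
        + (fst v * dx d p + snd v * du d p)))"
    by (simp add: Y ode_field_def)
  then show ?thesis
    using assms(1)
    by (simp add: levi_civita_def christoffel_ode_metric derivation_eq smooth_on_differentiable[of U] assms
        Y ode_field_def smooth_phi algebra_simps)
qed

text \<open>This is - \<open>partial_u\<close> (A \<phi>), because the bracket of
  \<open>partial_u\<close> and A is \<phi>_u \<open>partial_u\<close>. The form with A applied to
  \<phi>_u is the one that enters the Jacobi equation.\<close>

lemma gauss_curvature_ode_metric:
  assumes p: "p \<in> U"
  shows "gauss_curvature (ode_metric \<phi>) p = - A (du \<phi>) p - (du \<phi> p)\<^sup>2"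
proof -
  let ?g = "ode_metric \<phi>"
  note sm = smooth_phi smooth_on_partials[OF smooth_phi] smooth_on_const[OF open_U]
    smooth_on_mult[OF open_U] smooth_on_uminus[OF open_U]
  have e2: "(0, 1) = 0 *\<^sub>R ode_field \<phi> q + 1 *\<^sub>R (0, 1)" for q
    by simp
  \<comment> \<open>The two formulas differ through \<theta>, which is 1 on \<open>(0, 1)\<close>
    and - \<phi> on \<open>(1, 0)\<close>.\<close>
  have uu: "levi_civita ?g (\<lambda>_. (0, 1)) (\<lambda>_. (0, 1)) q
      = (- du \<phi> q) *\<^sub>R ode_field \<phi> q + 0 *\<^sub>R (0, 1)" if "q \<in> U" for q
    by (subst levi_civita_ode_metric[OF that _ _ e2]) (simp_all add: sm)
  have xu: "levi_civita ?g (\<lambda>_. (1, 0)) (\<lambda>_. (0, 1)) q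
      = (du \<phi> q * \<phi> q) *\<^sub>R ode_field \<phi> q + 0 *\<^sub>R (0, 1)" if "q \<in> U" for q
    by (subst levi_civita_ode_metric[OF that _ _ e2]) (simp_all add: sm)
  have lb: "lie_bracket (\<lambda>_. (1, 0)) (\<lambda>_. (0, 1)) = (\<lambda>q::real\<times>real. 0 :: real \<times> real)"
    by (simp add: lie_bracket_def fun_eq_iff)
  have "levi_civita ?g (\<lambda>q. 0) (\<lambda>_. (0, 1)) p = 0"
    by (subst levi_civita_ode_metric[OF p _ _ e2]) (simp_all add: sm zero_prod_def)
  moreover have "((\<lambda>q. - du \<phi> q) has_derivative (\<lambda>v. fst v * - dx (du \<phi>) p + snd v * - du (du \<phi>) p)) (at p)"
    by (rule derivative_eq_intros has_derivative_partials[OF sm(3) p] refl | simp add: algebra_simps)+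
  then have "dx (\<lambda>q. - du \<phi> q) p = - dx (du \<phi>) p" "du (\<lambda>q. - du \<phi> q) p = - du (du \<phi>) p"
    by (rule partials_eq)+
  then have "levi_civita ?g (\<lambda>_. (1, 0)) (levi_civita ?g (\<lambda>_. (0, 1)) (\<lambda>_. (0, 1))) p
     = (- dx (du \<phi>) p) *\<^sub>R ode_field \<phi> p + (\<phi> p * (du \<phi> p)\<^sup>2) *\<^sub>R (0, 1)"
    by (subst levi_civita_ode_metric[OF p _ _ uu])
      (simp_all add: sm derivation_eq smooth_on_differentiable[of U] p power2_eq_square)
  moreover have "((\<lambda>q. du \<phi> q * \<phi> q) has_derivative (\<lambda>v.
      fst v * (dx (du \<phi>) p * \<phi> p + du \<phi> p * dx \<phi> p)
      + snd v * (du (du \<phi>) p * \<phi> p + du \<phi> p * du \<phi> p))) (at p)"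
    by (rule derivative_eq_intros has_derivative_partials[OF sm(1) p] has_derivative_partials[OF sm(3) p] refl
        | simp add: algebra_simps)+
  then have "du (\<lambda>q. du \<phi> q * \<phi> q) p = du (du \<phi>) p * \<phi> p + du \<phi> p * du \<phi> p"
    by (rule partials_eq)
  then have "levi_civita ?g (\<lambda>_. (0, 1)) (levi_civita ?g (\<lambda>_. (1, 0)) (\<lambda>_. (0, 1))) p
     = (du (du \<phi>) p * \<phi> p + du \<phi> p * du \<phi> p) *\<^sub>R ode_field \<phi> p + (\<phi> p * (du \<phi> p)\<^sup>2) *\<^sub>R (0, 1)"
    by (subst levi_civita_ode_metric[OF p _ _ xu])
      (simp_all add: sm derivation_eq smooth_on_differentiable[of U] p power2_eq_square)
  \<comment> \<open>The \<open>partial_u\<close> components of the two second derivatives agree and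
    cancel. The remaining multiple of A is paired with \<open>(1, 0)\<close>, where g(A,
    \<open>(1, 0)\<close>) = 1, and the denominator is (1 + \<phi>^2) - \<phi>^2 = 1.\<close>
  ultimately show ?thesis
    by (simp add: gauss_curvature_def riemann_curvature_def lb ode_metric_eq ode_field_def
        derivation_eq smooth_on_differentiable[of U] sm p power2_eq_square algebra_simps)
qed

text \<open>Since \<theta>(A) = 0, the frame does not rotate along A, and each covariant derivative
  along A just differentiates the frame coefficients. The curvature term acts on J - g(J, A) A =
  \<delta> \<open>partial_u\<close> alone, so the two coefficients decouple.\<close>

lemma jacobi_equations:
  assumes "jacobi_field U \<phi> J" and s: "smooth_on U \<sigma>" and d: "smooth_on U \<delta>"
    and J: "\<forall>p\<in>U. J p = \<sigma> p *\<^sub>R ode_field \<phi> p + \<delta> p *\<^sub>R partial_u p" and p: "p \<in> U"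
  shows "A (A \<sigma>) p = 0" "A (A \<delta>) p = (A (du \<phi>) p + (du \<phi> p)\<^sup>2) * \<delta> p"
proof -
  let ?g = "ode_metric \<phi>"
  have A1: "\<theta> q (ode_field \<phi> q) = 0" for q
    by (simp add: ode_field_def)
  have J': "J q = \<sigma> q *\<^sub>R ode_field \<phi> q + \<delta> q *\<^sub>R (0, 1)" if "q \<in> U" for q
    using J that by (simp add: partial_u_def)
  have 1: "levi_civita ?g (ode_field \<phi>) J q = A \<sigma> q *\<^sub>R ode_field \<phi> q + A \<delta> q *\<^sub>R (0, 1)" if "q \<in> U" for q
    by (subst levi_civita_ode_metric[OF that s d J']) (simp_all add: A1)
  have 2: "levi_civita ?g (ode_field \<phi>) (levi_civita ?g (ode_field \<phi>) J) p
      = A (A \<sigma>) p *\<^sub>R ode_field \<phi> p + A (A \<delta>) p *\<^sub>R (0, 1)"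
    by (subst levi_civita_ode_metric[OF p smooth_on_derivation[OF s] smooth_on_derivation[OF d] 1])
       (simp_all add: A1)
  have "levi_civita ?g (ode_field \<phi>) (levi_civita ?g (ode_field \<phi>) J) p
        + gauss_curvature ?g p *\<^sub>R (?g p (ode_field \<phi> p) (ode_field \<phi> p) *\<^sub>R J p
          - ?g p (J p) (ode_field \<phi> p) *\<^sub>R ode_field \<phi> p) = 0"
    using assms(1) p by (simp add: jacobi_field_def Let_def)
  then have "A (A \<sigma>) p *\<^sub>R ode_field \<phi> p
      + (A (A \<delta>) p - (A (du \<phi>) p + (du \<phi> p)\<^sup>2) * \<delta> p) *\<^sub>R (0, 1) = 0"
    unfolding 2 J'[OF p] gauss_curvature_ode_metric[OF p]
    by (simp add: ode_metric_eq ode_field_def algebra_simps)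
  then show "A (A \<sigma>) p = 0" "A (A \<delta>) p = (A (du \<phi>) p + (du \<phi> p)\<^sup>2) * \<delta> p"
    by (auto simp: ode_field_def prod_eq_iff)
qed

end

section \<open>First integrals and integrating factors\<close>

text \<open>The Poincare lemma for the closed form a dx + b du on a convex set. Differentiating
  under the integral sign and using closedness turns the integrand into the t-derivative of t times
  the coefficients, which integrates to their values at the end point.\<close>

lemma segment_integral_has_derivative:
  fixes a b :: "real \<times> real \<Rightarrow> real"
  assumes B: "open B" "convex B" "p0 \<in> B" and a: "smooth_on B a" and b: "smooth_on B b"
    and closed: "\<And>p. p \<in> B \<Longrightarrow> du a p = dx b p" and p: "p \<in> B"
  shows "((\<lambda>p. integral {0..1} (\<lambda>t. a (p0 + t *\<^sub>R (p - p0)) * (fst p - fst p0)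
        + b (p0 + t *\<^sub>R (p - p0)) * (snd p - snd p0)))
      has_derivative (\<lambda>v. a p * fst v + b p * snd v)) (at p)"
proof -
  let ?q = "\<lambda>p t. p0 + t *\<^sub>R (p - p0)"
  \<comment> \<open>\<open>c f p t\<close> is the t-derivative of
    \<open>t * f (?q p t)\<close>.\<close>
  define c where "c f p t = f (?q p t)
      + t * (dx f (?q p t) * (fst p - fst p0) + du f (?q p t) * (snd p - snd p0))" for f p t
  \<comment> \<open>\<open>leibniz_rule\<close> takes the derivative of the integrand as a bounded
    linear map, hence the passage to \<open>Blinfun\<close>.\<close>
  define D :: "real \<times> real \<Rightarrow> real \<Rightarrow> (real \<times> real) \<Rightarrow>\<^sub>L real"
    where "D p t = c a p t *\<^sub>R Blinfun fst + c b p t *\<^sub>R Blinfun snd" for p t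
  have app: "blinfun_apply (Blinfun fst) v = fst v" "blinfun_apply (Blinfun snd) v = snd v"
    for v :: "real \<times> real"
    by (simp_all add: bounded_linear_Blinfun_apply bounded_linear_fst bounded_linear_snd)
  have app_D: "blinfun_apply (D p t) v = c a p t * fst v + c b p t * snd v" for p t v
    by (simp add: D_def blinfun.add_left blinfun.scaleR_left app)
  have q: "?q p t \<in> B" if "p \<in> B" "t \<in> {0..1}" for p t
  proof -
    have "?q p t = (1 - t) *\<^sub>R p0 + t *\<^sub>R p"
      by (simp add: algebra_simps)
    then show ?thesis
      using convexD_alt[OF B(2,3) that(1)] that(2) by simp
  qed
  have chain: "((\<lambda>p. f (?q p t)) has_derivative
      (\<lambda>v. t * fst v * dx f (?q p t) + t * snd v * du f (?q p t))) (at p within B)"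
    if "smooth_on B f" "p \<in> B" "t \<in> {0..1}" for f p t
  proof -
    have "((\<lambda>p. ?q p t) has_derivative (\<lambda>v. t *\<^sub>R v)) (at p within B)"
      by (auto intro!: derivative_eq_intros)
    from has_derivative_compose[OF this has_derivative_partials[OF that(1) q[OF that(2,3)]]]
    show ?thesis by simp
  qed
  \<comment> \<open>The factor t removes the contribution of the base point and leaves only f(p) at
    t = 1.\<close>
  have int_c: "(c f p has_integral f p) {0..1}" if f: "smooth_on B f" for f
  proof -
    have "((\<lambda>t. t * f (?q p t)) has_real_derivative c f p t) (at t within {0..1})"
      if t: "t \<in> {0..1}" for t
    proof -
      have "((\<lambda>t. ?q p t) has_derivative (\<lambda>h. h *\<^sub>R (p - p0))) (at t within {0..1})"
        by (auto intro!: derivative_eq_intros)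
      from has_derivative_compose[OF this has_derivative_partials[OF f q[OF p t]]]
      have "((\<lambda>t. f (?q p t)) has_real_derivative
          (fst p - fst p0) * dx f (?q p t) + (snd p - snd p0) * du f (?q p t)) (at t within {0..1})"
        unfolding has_field_derivative_def by (rule has_derivative_eq_rhs) (auto simp: algebra_simps)
      from DERIV_mult[OF DERIV_ident this] show ?thesis
        by (simp add: c_def algebra_simps)
    qed
    then have "(c f p has_integral 1 * f (?q p 1) - 0 * f (?q p 0)) {0..1}"
      by (intro fundamental_theorem_of_calculus)
        (auto simp: has_real_derivative_iff_has_vector_derivative[symmetric])
    then show ?thesis by simp
  qed
  have cont: "continuous_on (B \<times> {0..1}) (\<lambda>(p, t). f (?q p t))" if "smooth_on B f" for f
    unfolding split_beta
    by (rule continuous_on_compose2[OF smooth_on_imp_continuous_on[OF that]])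
      (auto intro!: continuous_intros q)
  have cont_segment: "continuous_on {0..1} (\<lambda>t. f (?q p t))"
    if "smooth_on B f" "p \<in> B" for p and f :: "real \<times> real \<Rightarrow> real"
    by (rule continuous_on_compose2[OF smooth_on_imp_continuous_on[OF that(1)]])
      (auto intro!: continuous_intros q that(2))
  have cont_c: "continuous_on (B \<times> {0..1}) (\<lambda>(p, t). c f p t)" if "smooth_on B f" for f
    using cont[OF that] cont[OF smooth_on_partials(1)[OF that]] cont[OF smooth_on_partials(2)[OF that]]
    unfolding c_def split_beta by (intro continuous_intros) auto
  have "((\<lambda>p. integral (cbox 0 1) (\<lambda>t. a (?q p t) * (fst p - fst p0) + b (?q p t) * (snd p - snd p0)))
      has_derivative blinfun_apply (integral (cbox 0 1) (D p))) (at p within B)"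
  proof (rule leibniz_rule[OF _ _ _ p B(2)])
    fix p t :: "_" assume pt: "p \<in> B" "t \<in> cbox (0::real) 1"
    then have t: "t \<in> {0..1}" by simp
    define r where "r = ?q p t"
    have cl: "du a r = dx b r"
      unfolding r_def by (rule closed[OF q[OF pt(1) t]])
    have "((\<lambda>p. a (?q p t) * (fst p - fst p0) + b (?q p t) * (snd p - snd p0)) has_derivative
        (\<lambda>v. (a (?q p t) * fst v
            + (t * fst v * dx a (?q p t) + t * snd v * du a (?q p t)) * (fst p - fst p0))
          + (b (?q p t) * snd v
            + (t * fst v * dx b (?q p t) + t * snd v * du b (?q p t)) * (snd p - snd p0))))
        (at p within B)"
      by (intro has_derivative_add has_derivative_mult chain a b pt t) (auto intro!: derivative_eq_intros)
    \<comment> \<open>The product rule yields the cross terms t b_x and t a_u; exchanging them by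
      closedness gives exactly the coefficients \<open>c a p t\<close> and
      \<open>c b p t\<close>.\<close>
    then show "((\<lambda>p. a (?q p t) * (fst p - fst p0) + b (?q p t) * (snd p - snd p0)) has_derivative
        blinfun_apply (D p t)) (at p within B)"
      by (rule has_derivative_eq_rhs)
        (rule ext, unfold app_D c_def r_def[symmetric], simp add: cl algebra_simps)
  next
    fix p assume "p \<in> B"
    then show "(\<lambda>t. a (?q p t) * (fst p - fst p0) + b (?q p t) * (snd p - snd p0)) integrable_on cbox 0 1"
      unfolding box_real
      by (intro integrable_continuous_real continuous_on_add continuous_on_mult continuous_on_const
          cont_segment a b)
  next
    show "continuous_on (B \<times> cbox 0 1) (\<lambda>(p, t). D p t)"
      using cont_c[OF a] cont_c[OF b] unfolding D_def split_beta box_real by (intro continuous_intros)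
  qed
  moreover have "(D p has_integral a p *\<^sub>R Blinfun fst + b p *\<^sub>R Blinfun snd) {0..1}"
    unfolding D_def by (intro has_integral_add has_integral_scaleR_left int_c a b)
  then have "integral (cbox 0 1) (D p) = a p *\<^sub>R Blinfun fst + b p *\<^sub>R Blinfun snd"
    by (simp add: integral_unique)
  ultimately have "((\<lambda>p. integral {0..1} (\<lambda>t. a (?q p t) * (fst p - fst p0) + b (?q p t) * (snd p - snd p0)))
      has_derivative blinfun_apply (a p *\<^sub>R Blinfun fst + b p *\<^sub>R Blinfun snd)) (at p within B)"
    by simp
  then have "((\<lambda>p. integral {0..1} (\<lambda>t. a (?q p t) * (fst p - fst p0) + b (?q p t) * (snd p - snd p0)))
      has_derivative (\<lambda>v. a p * fst v + b p * snd v)) (at p within B)"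
    by (rule has_derivative_eq_rhs) (simp add: fun_eq_iff blinfun.add_left blinfun.scaleR_left app)
  then show ?thesis
    using at_within_open[OF p B(1)] by simp
qed

text \<open>The differential of \<open>F\<close> has smooth coefficients, so \<open>F\<close> is
  smooth too.\<close>

lemma pfaff_differential_smooth_on:
  assumes "open V" "smooth_on V \<phi>" "smooth_on V \<mu>" "pfaff_differential V \<phi> \<mu> F"
  shows "smooth_on V F"
proof (rule smooth_onI[OF assms(1)])
  show "(F has_derivative (\<lambda>v. \<mu> p * (-1 * \<phi> p * fst v + snd v))) (at p)" if "p \<in> V" for p
    using assms(4) that by (simp add: pfaff_differential_def)
  show "smooth_on V (\<lambda>p. \<mu> p * (-1 * \<phi> p * fst v + snd v))" for v
    by (intro smooth_on_mult smooth_on_add smooth_on_const assms)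
qed

text \<open>The equation for \<mu> says that \<mu> (- \<phi> dx + du) is closed. On a ball the
  segment integral from the centre is then a primitive, and the same integral witnesses the
  quadrature.\<close>

lemma local_primitive:
  assumes "open U" "smooth_on U \<phi>" "smooth_on U \<mu>"
    and nz: "\<And>p. p \<in> U \<Longrightarrow> \<mu> p \<noteq> 0"
    and eq: "\<And>p. p \<in> U \<Longrightarrow> derivation (ode_field \<phi>) \<mu> p = - du \<phi> p * \<mu> p"
    and "p0 \<in> U"
  shows "\<exists>V F. open V \<and> p0 \<in> V \<and> V \<subseteq> U \<and> nonvanishing_smooth_on V \<mu> \<and> smooth_on V F
    \<and> pfaff_differential V \<phi> \<mu> F \<and> pfaff_quadrature_on V \<phi> \<mu> F"
proof -
  obtain e where e: "e > 0" "ball p0 e \<subseteq> U"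
    using assms(1,6) openE by blast
  define V where "V = ball p0 e"
  have V: "open V" "convex V" "p0 \<in> V" "V \<subseteq> U"
    using e by (auto simp: V_def)
  have sm: "smooth_on V \<phi>" "smooth_on V \<mu>"
    using assms(2,3) V(4) smooth_on_subset by blast+
  \<comment> \<open>The dx-coefficient of the form \<mu> (- \<phi> dx + du); its du-coefficient is
    \<mu> itself.\<close>
  define a where "a p = -1 * \<mu> p * \<phi> p" for p
  have a: "smooth_on V a"
    unfolding a_def by (intro smooth_on_mult smooth_on_const V sm)
  have closed: "du a p = dx \<mu> p" if "p \<in> V" for p
  proof -
    have "derivation partial_u a p = - (\<mu> p * du \<phi> p + du \<mu> p * \<phi> p)"
      using derivation_mult[OF smooth_on_mult[OF V(1) smooth_on_const[OF V(1)] sm(2)] sm(1) that,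
          of partial_u "-1"]
        derivation_mult[OF smooth_on_const[OF V(1)] sm(2) that, of partial_u "-1"]
        derivation_eq[OF smooth_on_differentiable[OF sm(1) that], of partial_u]
        derivation_eq[OF smooth_on_differentiable[OF sm(2) that], of partial_u]
      by (simp add: a_def[abs_def] partial_u_def algebra_simps)
    moreover have "derivation partial_u a p = du a p"
      using that a by (simp add: derivation_eq smooth_on_differentiable partial_u_def)
    moreover have "dx \<mu> p + \<phi> p * du \<mu> p = - du \<phi> p * \<mu> p"
      using eq[of p] that V(4) derivation_ode_field[OF sm(2) that, of \<phi>] by auto
    ultimately show ?thesis by (simp add: algebra_simps)
  qed
  define F where "F p = integral {0..1} (\<lambda>t. a (p0 + t *\<^sub>R (p - p0)) * (fst p - fst p0)
      + \<mu> (p0 + t *\<^sub>R (p - p0)) * (snd p - snd p0))" for p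
  have "(F has_derivative (\<lambda>v. a p * fst v + \<mu> p * snd v)) (at p)" if "p \<in> V" for p
    unfolding F_def[abs_def] by (rule segment_integral_has_derivative[OF V(1,2,3) a sm(2) closed that])
  then have dF: "pfaff_differential V \<phi> \<mu> F"
    by (simp add: pfaff_differential_def a_def algebra_simps)
  have seg: "closed_segment p0 p \<subseteq> V" if "p \<in> V" for p
    by (rule closed_segment_subset[OF V(3) that V(2)])
  have "((\<lambda>t. let q = p0 + t *\<^sub>R (p - p0) in
              \<mu> q * (- \<phi> q * (fst p - fst p0) + (snd p - snd p0))) has_integral F p) {0..1}"
    if "p \<in> V" for p
  proof -
    have q: "p0 + t *\<^sub>R (p - p0) \<in> V" if "t \<in> {0..1}" for t
      using convexD_alt[OF V(2,3) \<open>p \<in> V\<close>, of t] that by (simp add: algebra_simps)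
    have "(\<lambda>t. a (p0 + t *\<^sub>R (p - p0)) * (fst p - fst p0)
      + \<mu> (p0 + t *\<^sub>R (p - p0)) * (snd p - snd p0)) integrable_on {0..1}"
      using q by (intro integrable_continuous_interval continuous_intros
          continuous_on_compose2[OF smooth_on_imp_continuous_on[OF a]]
          continuous_on_compose2[OF smooth_on_imp_continuous_on[OF sm(2)]]) auto
    then show ?thesis
      unfolding F_def by (simp add: has_integral_integral a_def Let_def algebra_simps)
  qed
  then have "pfaff_quadrature_on V \<phi> \<mu> F"
    using V(3) seg unfolding pfaff_quadrature_on_def by blast
  moreover have "nonvanishing_smooth_on V \<mu>"
    using sm nz V(4) by (auto simp: nonvanishing_smooth_on_def)
  ultimately show ?thesis
    using V dF pfaff_differential_smooth_on[OF V(1) sm dF] by blast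
qed

text \<open>A f = 0 determines f_x, and df becomes f_u (- \<phi> dx + du). So \<open>du f\<close> is
  the multiplier wherever it does not vanish.\<close>

lemma first_integral_if_derivation_zero:
  assumes "open U" "connected U" "smooth_on U \<phi>" "smooth_on U f"
    and A0: "\<And>p. p \<in> U \<Longrightarrow> derivation (ode_field \<phi>) f p = 0" and "\<not> f constant_on U"
  shows "\<exists>V. open V \<and> V \<noteq> {} \<and> V \<subseteq> U \<and> first_integral_on V \<phi> f"
proof -
  have df: "(f has_derivative (\<lambda>v. du f p * (- \<phi> p * fst v + snd v))) (at p)" if "p \<in> U" for p
  proof -
    have "dx f p = - (\<phi> p * du f p)"
      using A0[OF that] derivation_ode_field[OF assms(4) that, of \<phi>] by simp
    then show ?thesis
      using has_derivative_partials[OF assms(4) that] by (simp add: algebra_simps)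
  qed
  \<comment> \<open>If f_u vanished throughout \<open>U\<close>, then df would be 0 and
    \<open>f\<close> would be constant on the connected set \<open>U\<close>.\<close>
  obtain p where p: "p \<in> U" "du f p \<noteq> 0"
  proof (rule ccontr)
    assume "\<not> thesis"
    then have "(f has_derivative (\<lambda>v. 0)) (at p)" if "p \<in> U" for p
      using df[OF that] that \<open>\<And>p. p \<in> U \<Longrightarrow> du f p \<noteq> 0 \<Longrightarrow> thesis\<close> by (cases "du f p = 0") auto
    then have "f constant_on U"
      using has_derivative_zero_unique_connected[OF assms(1,2)] unfolding constant_on_def by metis
    then show False using assms(6) by simp
  qed
  define V where "V = {p \<in> U. du f p \<noteq> 0}"
  have "open V"
    unfolding V_def by (rule open_nonzero_set[OF assms(1) smooth_on_partials(2)[OF assms(4)]])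
  moreover have "V \<subseteq> U" "p \<in> V"
    using p by (auto simp: V_def)
  moreover have "first_integral_on V \<phi> f"
    unfolding first_integral_on_def nonvanishing_smooth_on_def pfaff_differential_def
    using smooth_on_subset[OF assms(4) \<open>V \<subseteq> U\<close>] smooth_on_subset[OF smooth_on_partials(2)[OF assms(4)] \<open>V \<subseteq> U\<close>] df
    by (auto simp: V_def)
  ultimately show ?thesis by blast
qed

section \<open>The operator \<open>frak_S\<close> and the second Jacobi equation\<close>

lemma smooth_on_frak_S:
  assumes "open U" "smooth_on U \<phi>" "smooth_on U \<delta>"
  shows "smooth_on U (frak_S \<phi> \<delta>)"
    and "p \<in> U \<Longrightarrow> frak_S \<phi> \<delta> p = derivation (ode_field \<phi>) \<delta> p - du \<phi> p * \<delta> p"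
proof -
  have eq: "frak_S \<phi> \<delta> p = derivation (ode_field \<phi>) \<delta> p - du \<phi> p * \<delta> p" if "p \<in> U" for p
    by (simp add: frak_S_def derivation_eq[OF smooth_on_differentiable[OF assms(2) that], of partial_u]
        partial_u_def)
  have "smooth_on U (\<lambda>p. derivation (ode_field \<phi>) \<delta> p - du \<phi> p * \<delta> p)"
    by (intro smooth_on_diff smooth_on_mult smooth_on_derivation smooth_on_partials assms)
  then show "smooth_on U (frak_S \<phi> \<delta>)"
    by (rule smooth_on_cong[OF assms(1), rotated]) (simp add: eq)
  show "p \<in> U \<Longrightarrow> frak_S \<phi> \<delta> p = derivation (ode_field \<phi>) \<delta> p - du \<phi> p * \<delta> p"
    by (rule eq)
qed

text \<open>The second-order operator factors: (A + \<phi>_u)(A - \<phi>_u) \<delta> = A(A \<delta>)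
  - (A \<phi>_u + \<phi>_u^2) \<delta>, which is 0 by \<open>jac\<close>.\<close>

lemma derivation_frak_S:
  assumes "open U" "smooth_on U \<phi>" "smooth_on U \<delta>" and p: "p \<in> U"
    and jac: "derivation (ode_field \<phi>) (derivation (ode_field \<phi>) \<delta>) p =
      (derivation (ode_field \<phi>) (du \<phi>) p + (du \<phi> p)\<^sup>2) * \<delta> p"
  shows "derivation (ode_field \<phi>) (frak_S \<phi> \<delta>) p = - du \<phi> p * frak_S \<phi> \<delta> p"
proof -
  let ?A = "derivation (ode_field \<phi>)"
  note sm = smooth_on_derivation[OF assms(1-3)] smooth_on_partials(2)[OF assms(2)]
  have "?A (frak_S \<phi> \<delta>) p = ?A (\<lambda>q. ?A \<delta> q - du \<phi> q * \<delta> q) p"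
    by (rule derivation_cong_open[OF assms(1) p smooth_on_frak_S(2)[OF assms(1-3)]])
  also have "\<dots> = ?A (?A \<delta>) p - (du \<phi> p * ?A \<delta> p + ?A (du \<phi>) p * \<delta> p)"
    using derivation_diff[OF sm(1) smooth_on_mult[OF assms(1) sm(2) assms(3)] p]
      derivation_mult[OF sm(2) assms(3) p] by simp
  also have "\<dots> = - du \<phi> p * frak_S \<phi> \<delta> p"
    by (simp add: jac smooth_on_frak_S(2)[OF assms(1-4)] power2_eq_square algebra_simps)
  finally show ?thesis .
qed

lemma integrating_factor_onI:
  "nonvanishing_smooth_on V \<mu> \<Longrightarrow> smooth_on V F \<Longrightarrow> pfaff_differential V \<phi> \<mu> F
    \<Longrightarrow> integrating_factor_on V \<phi> \<mu>"
  unfolding integrating_factor_on_def by blast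

lemma first_integral_onI:
  "nonvanishing_smooth_on V \<mu> \<Longrightarrow> smooth_on V F \<Longrightarrow> pfaff_differential V \<phi> \<mu> F
    \<Longrightarrow> first_integral_on V \<phi> F"
  unfolding first_integral_on_def by blast

section \<open>First integrals and integrating factors from a Jacobi field\<close>

theorem mainTheorem1:
  fixes U :: "(real \<times> real) set"
    and \<phi> \<sigma> \<delta> :: "real \<times> real \<Rightarrow> real"
    and J :: "real \<times> real \<Rightarrow> real \<times> real"
  assumes "open U" and "connected U" and "U \<noteq> {}"
    and "smooth_on U \<phi>"
    and "nontrivial_jacobi_field U \<phi> J"
    and "smooth_on U \<sigma>" and "smooth_on U \<delta>"
    and "\<forall>p\<in>U. J p = \<sigma> p *\<^sub>R ode_field \<phi> p + \<delta> p *\<^sub>R partial_u p"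
  shows
    "(let A = derivation (ode_field \<phi>); F = A \<sigma> in
        (\<forall>p\<in>U. A F p = 0) \<and>
        (\<not> F constant_on U \<longrightarrow>
           (\<exists>V. open V \<and> V \<noteq> {} \<and> V \<subseteq> U \<and> first_integral_on V \<phi> F)))
     \<and>
     (\<forall>a. (\<forall>p\<in>U. derivation (ode_field \<phi>) \<sigma> p = a) \<longrightarrow>
       (let A = derivation (ode_field \<phi>); G = (\<lambda>p. \<sigma> p - a * fst p) in
          (\<forall>p\<in>U. A G p = 0) \<and>
          (\<not> G constant_on U \<longrightarrow>
             (\<exists>V. open V \<and> V \<noteq> {} \<and> V \<subseteq> U \<and> first_integral_on V \<phi> G))))
     \<and>
     (\<forall>a b. (\<forall>p\<in>U. derivation (ode_field \<phi>) \<sigma> p = a) \<and> (\<forall>p\<in>U. \<sigma> p - a * fst p = b) \<longrightarrow>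
        \<not> (\<forall>p\<in>U. \<delta> p = 0))
     \<and>
     (\<not> (\<forall>p\<in>U. \<delta> p = 0) \<longrightarrow>
        ((\<forall>p\<in>U. frak_S \<phi> \<delta> p = 0) \<longrightarrow>
           (\<forall>p\<in>U. \<delta> p \<noteq> 0 \<longrightarrow>
              (\<exists>V. open V \<and> p \<in> V \<and> V \<subseteq> U \<and> integrating_factor_on V \<phi> (\<lambda>q. inverse (\<delta> q)))))
        \<and>
        (\<not> (\<forall>p\<in>U. frak_S \<phi> \<delta> p = 0) \<longrightarrow>
           (\<forall>p\<in>U. frak_S \<phi> \<delta> p \<noteq> 0 \<longrightarrow>
              (\<exists>V. open V \<and> p \<in> V \<and> V \<subseteq> U \<and> integrating_factor_on V \<phi> (frak_S \<phi> \<delta>)))))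
     \<and>
     (\<exists>V F. open V \<and> V \<noteq> {} \<and> V \<subseteq> U \<and> first_integral_on V \<phi> F \<and>
        ((\<forall>p\<in>V. F p = derivation (ode_field \<phi>) \<sigma> p)
         \<or> (\<exists>a. (\<forall>p\<in>U. derivation (ode_field \<phi>) \<sigma> p = a) \<and> (\<forall>p\<in>V. F p = \<sigma> p - a * fst p))
         \<or> (\<exists>\<mu>\<in>{\<lambda>q. inverse (\<delta> q), frak_S \<phi> \<delta>}.
              integrating_factor_on V \<phi> \<mu> \<and> pfaff_quadrature_on V \<phi> \<mu> F)))"
proof -
  let ?A = "derivation (ode_field \<phi>)"
  let ?S = "frak_S \<phi> \<delta>"
  have jacobi: "jacobi_field U \<phi> J" and nontrivial: "\<not> trivial_jacobi_field U \<phi> J"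
    using assms(5) by (simp_all add: nontrivial_jacobi_field_def)
  note jac = jacobi_equations[OF assms(1,4) jacobi assms(6-8)]
  have part1: "\<exists>V. open V \<and> V \<noteq> {} \<and> V \<subseteq> U \<and> first_integral_on V \<phi> (?A \<sigma>)"
    if "\<not> ?A \<sigma> constant_on U"
    using first_integral_if_derivation_zero[OF assms(1,2,4) smooth_on_derivation[OF assms(1,4,6)]
        jac(1) that] .
  have part2: "?A (\<lambda>p. \<sigma> p - a * fst p) p = 0" if "\<forall>p\<in>U. ?A \<sigma> p = a" "p \<in> U" for a p
  proof -
    \<comment> \<open>The dx-component of A is 1, so A(x) = 1 and the term a x absorbs the constant
      A(\<sigma>).\<close>
    have "?A (\<lambda>p. a * fst p) p = a"
      by (subst derivation_eq_has_derivative[of _ "\<lambda>v. a * fst v"])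
        (auto intro!: derivative_eq_intros simp: ode_field_def)
    then show ?thesis
      using derivation_diff[OF assms(6) smooth_on_mult[OF assms(1) smooth_on_const[OF assms(1)]
            smooth_on_fst[OF assms(1)]] that(2)] that by simp
  qed
  have part2': "\<exists>V. open V \<and> V \<noteq> {} \<and> V \<subseteq> U \<and> first_integral_on V \<phi> (\<lambda>p. \<sigma> p - a * fst p)"
    if "\<forall>p\<in>U. ?A \<sigma> p = a" "\<not> (\<lambda>p. \<sigma> p - a * fst p) constant_on U" for a
    by (rule first_integral_if_derivation_zero[OF assms(1,2,4) _ part2[OF that(1)] that(2)])
      (intro smooth_on_diff smooth_on_mult smooth_on_const smooth_on_fst assms)
  have part3: "\<not> (\<forall>p\<in>U. \<delta> p = 0)" if "\<forall>p\<in>U. \<sigma> p - a * fst p = b" for a b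
  proof
    assume "\<forall>p\<in>U. \<delta> p = 0"
    then have "J p = (a * fst p + b) *\<^sub>R ode_field \<phi> p" if "p \<in> U" for p
      using assms(8) \<open>\<forall>p\<in>U. \<sigma> p - a * fst p = b\<close> that by (simp add: algebra_simps)
    then show False
      using nontrivial unfolding trivial_jacobi_field_def by blast
  qed
  \<comment> \<open>Common to both choices of integrating factor: \<open>h\<close> cuts out the open
    set \<open>W\<close> on which \<mu> is defined and nonzero. The pair (h, \<mu>) will be
    (\<delta>, 1 / \<delta>) and then (S, S), where S is
    \<open>frak_S \<phi> \<delta>\<close>.\<close>
  have prim: "\<exists>V F. open V \<and> p \<in> V \<and> V \<subseteq> U \<and> nonvanishing_smooth_on V \<mu> \<and> smooth_on V F
      \<and> pfaff_differential V \<phi> \<mu> F \<and> pfaff_quadrature_on V \<phi> \<mu> F"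
    if W: "W = {q \<in> U. h q \<noteq> 0}" and h: "smooth_on U h" and p: "p \<in> U" "h p \<noteq> 0"
      and mu: "smooth_on W h \<Longrightarrow> open W \<Longrightarrow> smooth_on W \<mu>" "\<And>q. q \<in> W \<Longrightarrow> \<mu> q \<noteq> 0"
        "\<And>q. q \<in> W \<Longrightarrow> ?A \<mu> q = - du \<phi> q * \<mu> q" for W \<mu> p and h :: "real \<times> real \<Rightarrow> real"
  proof -
    have "open W"
      unfolding W by (rule open_nonzero_set[OF assms(1) h])
    moreover have "W \<subseteq> U" "p \<in> W"
      using p by (auto simp: W)
    ultimately show ?thesis
      using local_primitive[OF \<open>open W\<close> smooth_on_subset[OF assms(4) \<open>W \<subseteq> U\<close>]
          mu(1)[OF smooth_on_subset[OF h \<open>W \<subseteq> U\<close>] \<open>open W\<close>] mu(2,3) \<open>p \<in> W\<close>]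
      by (blast intro: order_trans)
  qed
  have part4a: "\<exists>V F. open V \<and> p \<in> V \<and> V \<subseteq> U \<and> nonvanishing_smooth_on V (\<lambda>q. inverse (\<delta> q))
      \<and> smooth_on V F \<and> pfaff_differential V \<phi> (\<lambda>q. inverse (\<delta> q)) F
      \<and> pfaff_quadrature_on V \<phi> (\<lambda>q. inverse (\<delta> q)) F"
    if S0: "\<forall>p\<in>U. ?S p = 0" and p: "p \<in> U" "\<delta> p \<noteq> 0" for p
  proof (rule prim[OF refl assms(7) p])
    fix q assume q: "q \<in> {q \<in> U. \<delta> q \<noteq> 0}"
    \<comment> \<open>Here A \<delta> = \<phi>_u \<delta>, and inversion reverses the sign, so 1 /
      \<delta> satisfies the equation that makes the Pfaffian form closed.\<close>
    then have "?A \<delta> q = du \<phi> q * \<delta> q"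
      using S0 smooth_on_frak_S(2)[OF assms(1,4,7), of q] by simp
    then show "?A (\<lambda>q. inverse (\<delta> q)) q = - du \<phi> q * inverse (\<delta> q)"
      using q by (subst derivation_inverse[OF assms(7)]) (auto simp: power2_eq_square field_simps)
  qed (auto intro!: smooth_on_inverse)
  have part4b: "\<exists>V F. open V \<and> p \<in> V \<and> V \<subseteq> U \<and> nonvanishing_smooth_on V ?S
      \<and> smooth_on V F \<and> pfaff_differential V \<phi> ?S F \<and> pfaff_quadrature_on V \<phi> ?S F"
    if p: "p \<in> U" "?S p \<noteq> 0" for p
    by (rule prim[OF refl smooth_on_frak_S(1)[OF assms(1,4,7)] p])
      (auto simp: derivation_frak_S[OF assms(1,4,7) _ jac(2)])
  \<comment> \<open>The cases are tried in turn: A(\<sigma>) if it is not constant, then \<sigma> -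
    a x. If both are constant, \<delta> is nonzero somewhere, and a quadrature with 1 / \<delta> or
    with \<open>frak_S \<phi> \<delta>\<close> supplies the first integral.\<close>
  have final: "\<exists>V F. open V \<and> V \<noteq> {} \<and> V \<subseteq> U \<and> first_integral_on V \<phi> F \<and>
        ((\<forall>p\<in>V. F p = ?A \<sigma> p)
         \<or> (\<exists>a. (\<forall>p\<in>U. ?A \<sigma> p = a) \<and> (\<forall>p\<in>V. F p = \<sigma> p - a * fst p))
         \<or> (\<exists>\<mu>\<in>{\<lambda>q. inverse (\<delta> q), ?S}.
              integrating_factor_on V \<phi> \<mu> \<and> pfaff_quadrature_on V \<phi> \<mu> F))"
  proof (cases "?A \<sigma> constant_on U")
    case False
    then show ?thesis using part1 by blast
  next
    case True
    then obtain a where a: "\<forall>p\<in>U. ?A \<sigma> p = a"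
      unfolding constant_on_def by blast
    show ?thesis
    proof (cases "(\<lambda>p. \<sigma> p - a * fst p) constant_on U")
      case False
      obtain V where "open V" "V \<noteq> {}" "V \<subseteq> U" "first_integral_on V \<phi> (\<lambda>p. \<sigma> p - a * fst p)"
        using part2'[OF a False] by blast
      then show ?thesis using a by (intro exI[of _ V] exI[of _ "\<lambda>p. \<sigma> p - a * fst p"]) auto
    next
      case True
      then obtain p where p: "p \<in> U" "\<delta> p \<noteq> 0"
        using part3 unfolding constant_on_def by blast
      \<comment> \<open>The primitive of \<mu> (- \<phi> dx + du) plays two roles: it is the first
        integral with multiplier \<mu>, and it shows that \<mu> is an integrating factor.\<close>
      have quadrature: ?thesis
        if mu: "\<mu> \<in> {\<lambda>q. inverse (\<delta> q), ?S}"
          and ex: "\<exists>V F. open V \<and> r \<in> V \<and> V \<subseteq> U \<and> nonvanishing_smooth_on V \<mu>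
            \<and> smooth_on V F \<and> pfaff_differential V \<phi> \<mu> F \<and> pfaff_quadrature_on V \<phi> \<mu> F" for \<mu> r
      proof -
        obtain V F where "r \<in> V" and V: "open V" "V \<subseteq> U"
            and F: "nonvanishing_smooth_on V \<mu>" "smooth_on V F" "pfaff_differential V \<phi> \<mu> F"
            and quad: "pfaff_quadrature_on V \<phi> \<mu> F"
          using ex by (elim exE conjE) (rule that)
        then have "V \<noteq> {}"
          by blast
        then show ?thesis
          by (intro exI[of _ V] exI[of _ F] conjI V first_integral_onI[OF F] disjI2 bexI[OF _ mu]
              integrating_factor_onI[OF F] quad)
      qed
      show ?thesis
      proof (cases "\<forall>p\<in>U. ?S p = 0")
        case True
        show ?thesis
          by (rule quadrature[OF _ part4a[OF True p]]) simp
      next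
        case False
        then obtain r where r: "r \<in> U" "?S r \<noteq> 0"
          by blast
        show ?thesis
          by (rule quadrature[OF _ part4b[OF r]]) simp
      qed
    qed
  qed
  show ?thesis
    unfolding Let_def
  proof (intro conjI allI impI ballI)
    show "?A (?A \<sigma>) p = 0" if "p \<in> U" for p
      by (rule jac(1)[OF that])
    show "\<exists>V. open V \<and> V \<noteq> {} \<and> V \<subseteq> U \<and> first_integral_on V \<phi> (?A \<sigma>)"
      if "\<not> ?A \<sigma> constant_on U"
      by (rule part1[OF that])
    show "?A (\<lambda>p. \<sigma> p - a * fst p) p = 0" if "\<forall>p\<in>U. ?A \<sigma> p = a" "p \<in> U" for a p
      by (rule part2[OF that])
    show "\<exists>V. open V \<and> V \<noteq> {} \<and> V \<subseteq> U \<and> first_integral_on V \<phi> (\<lambda>p. \<sigma> p - a * fst p)"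
      if "\<forall>p\<in>U. ?A \<sigma> p = a" "\<not> (\<lambda>p. \<sigma> p - a * fst p) constant_on U" for a
      by (rule part2'[OF that])
    show "\<not> (\<forall>p\<in>U. \<delta> p = 0)"
      if "(\<forall>p\<in>U. ?A \<sigma> p = a) \<and> (\<forall>p\<in>U. \<sigma> p - a * fst p = b)" for a b
      using part3 that by blast
    show "\<exists>V. open V \<and> p \<in> V \<and> V \<subseteq> U \<and> integrating_factor_on V \<phi> (\<lambda>q. inverse (\<delta> q))"
      if "\<forall>p\<in>U. ?S p = 0" "p \<in> U" "\<delta> p \<noteq> 0" for p
      using part4a[OF that] integrating_factor_onI by blast
    show "\<exists>V. open V \<and> p \<in> V \<and> V \<subseteq> U \<and> integrating_factor_on V \<phi> ?S"
      if "p \<in> U" "?S p \<noteq> 0" for p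
      using part4b[OF that] integrating_factor_onI by blast
  qed (rule final)
qed

end
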